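(* Let $G$ be an Abelian group (written additively) and let $X\subseteq G$ be a subset. Then $X$ is semiaffine if and only if at least one of the following conditions holds: (1) $X=(H+a)\cup(H+b)$ for some subgroup $H$ of $G$ and some elements $a,b\in X$; (2) $X=(H\setminus C)+g$ for some $g\in G$, some subgroup $H\subseteq G$ and some midconvex set $C$ in the group $H$.
   Context: A subset $X$ of an Abelian group $G$ is called semiaffine if for all $x,y,z\in X$ we have $x+(y-z)\in X$ or $x-(y-z)\in X$. (The empty set is semiaffine.) A subset $C$ of an Abelian group $H$ is called midconvex (in $H$) if for all $x,y\in C$ the set $\frac{x+y}{2}:=\{z\in H: 2z=x+y\}$ is a subset of $C$; the empty set is midconvex. For a subset $A\subseteq G$ and $g\in G$, $A+g:=\{u+g:u\in A\}$. *)

theory Defs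
  imports "HOL-Algebra.AbelCoset"
begin

text \<open>
  Abelian groups are written additively, i.e. they satisfy the locale
  \<^locale>\<open>abelian_group\<close>, which only constrains the additive part of a ring record.
  The translate of a set \<open>A\<close> by \<open>g\<close> is \<open>A +>\<^bsub>G\<^esub> g\<close>, which the library
  defines for arbitrary sets \<open>A\<close>, not only for subgroups.
\<close>

definition semiaffine :: "('a, 'm) ring_scheme \<Rightarrow> 'a set \<Rightarrow> bool" where
  "semiaffine G X \<longleftrightarrow>
     X \<subseteq> carrier G \<and>
     (\<forall>x\<in>X. \<forall>y\<in>X. \<forall>z\<in>X.
        x \<oplus>\<^bsub>G\<^esub> (y \<ominus>\<^bsub>G\<^esub> z) \<in> X \<or> x \<ominus>\<^bsub>G\<^esub> (y \<ominus>\<^bsub>G\<^esub> z) \<in> X)"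

text \<open>
  The group \<open>H\<close> is a record of its own: midpoints are taken in \<open>carrier H\<close> only. For a
  subgroup \<open>H\<close> of \<open>G\<close>, midconvexity in \<open>H\<close> is \<open>midconvex (G\<lparr>carrier := H\<rparr>)\<close>, so
  halves lying in \<open>G\<close> but outside \<open>H\<close> are irrelevant.
\<close>

definition midpoints :: "('a, 'm) ring_scheme \<Rightarrow> 'a \<Rightarrow> 'a \<Rightarrow> 'a set" where
  "midpoints H x y = {z \<in> carrier H. [(2::nat)] \<cdot>\<^bsub>H\<^esub> z = x \<oplus>\<^bsub>H\<^esub> y}"

definition midconvex :: "('a, 'm) ring_scheme \<Rightarrow> 'a set \<Rightarrow> bool" where
  "midconvex H C \<longleftrightarrow>
     C \<subseteq> carrier H \<and> (\<forall>x\<in>C. \<forall>y\<in>C. midpoints H x y \<subseteq> C)"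

end

theory Submission
  imports Defs
begin

text \<open>
  After translating we may assume \<open>0 \<in> X\<close>. Put \<open>E = X - X\<close>; semiaffinity says that
  \<open>x + d \<in> X\<close> or \<open>x - d \<in> X\<close> for all \<open>x \<in> X\<close> and \<open>d \<in> E\<close>.

  If \<open>2x \<notin> E\<close> for some \<open>x \<in> X\<close>, then \<open>P = {z \<in> X. z + x \<in> X}\<close> is a subgroup and
  \<open>X = P \<union> (P + x)\<close>. The main point is that \<open>X\<close> is invariant under \<open>z \<mapsto> x - z\<close>.

  Otherwise \<open>E\<close> is a subgroup: since \<open>E = X \<union> -X\<close>, it suffices that \<open>x + y \<in> E\<close> for
  \<open>x, y \<in> X\<close>. If this fails, then \<open>x - y\<close> and \<open>y - x\<close> lie in \<open>X\<close>; but \<open>2x\<close> or \<open>-2x\<close> also lies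
  in \<open>X\<close>, and \<open>2x - (x - y) = (y - x) - (-2x) = x + y\<close>. Once \<open>E\<close> is a subgroup,
  semiaffinity is precisely midconvexity of \<open>E - X\<close> in \<open>E\<close>.
\<close>

section \<open>Calculation with differences\<close>

lemma (in abelian_group) a_inv_zero: "\<ominus> \<zero> = \<zero>"
  by (rule minus_equality) simp_all

text \<open>Registers the additive laws with \<open>algebra\<close>, so that it normalises terms in
  a bare abelian group, with no multiplication in sight.\<close>

lemmas (in abelian_group) abelian_group_simprules
  [algebra abelian_group "zero G" "add G" "a_inv G" "a_minus G"] =
  a_closed zero_closed a_inv_closed minus_closed
  a_assoc l_zero l_neg a_comm minus_eq
  r_zero r_neg r_neg2 r_neg1 minus_add minus_minus a_inv_zero a_lcomm

definition diffs :: "('a, 'm) ring_scheme \<Rightarrow> 'a set \<Rightarrow> 'a set" where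
  "diffs G X = {d. \<exists>y\<in>X. \<exists>z\<in>X. d = y \<ominus>\<^bsub>G\<^esub> z}"

lemma diffsI: "y \<in> X \<Longrightarrow> z \<in> X \<Longrightarrow> y \<ominus>\<^bsub>G\<^esub> z = d \<Longrightarrow> d \<in> diffs G X"
  by (auto simp: diffs_def)

text \<open>Both outcomes are given up to equations: a use names the simplified terms
  \<open>r\<close> and \<open>s\<close> and leaves the equations to \<open>algebra\<close>.\<close>

lemma semiaffineD:
  fixes G (structure)
  assumes "semiaffine G X" "x \<in> X" "y \<in> X" "z \<in> X"
    "x \<oplus> (y \<ominus> z) = r" "x \<ominus> (y \<ominus> z) = s"
  shows "r \<in> X \<or> s \<in> X"
  using assms unfolding semiaffine_def by blast

section \<open>The case of a double that is not a difference: two cosets\<close>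

context abelian_group
begin

text \<open>By \<open>nE\<close>, no two elements of \<open>X\<close> differ by \<open>2x\<close>
  (fact \<open>N\<close>). Each application of semiaffinity below is chosen so that \<open>N\<close>
  rules out one or both of its outcomes.\<close>

lemma semiaffine_reflect:
  assumes sa: "semiaffine G X" and 0: "\<zero> \<in> X" and x: "x \<in> X"
    and nE: "x \<oplus> x \<notin> diffs G X" and z: "z \<in> X" and zx: "z \<oplus> x \<in> X"
  shows "\<ominus> z \<in> X" "x \<ominus> z \<in> X"
proof -
  have c: "x \<in> carrier G" "z \<in> carrier G" using x z sa by (auto simp: semiaffine_def)
  have N: "w \<notin> X" if "v \<in> X" "w \<ominus> v = x \<oplus> x" for v w
    using nE diffsI[OF _ that] by blast
  have z2x: "z \<oplus> x \<oplus> x \<notin> X"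
    by (rule N[OF z]; use c in algebra)
  have "z \<oplus> x \<oplus> x \<in> X \<or> \<ominus> z \<in> X"
    by (rule semiaffineD[OF sa x zx 0]; use c in algebra)
  with z2x show mz: "\<ominus> z \<in> X" by blast
  show "x \<ominus> z \<in> X"
  proof (rule ccontr)
    assume nxz: "x \<ominus> z \<notin> X"
    have "\<ominus> z \<oplus> x \<in> X \<or> \<ominus> z \<ominus> x \<in> X"
      by (rule semiaffineD[OF sa mz x 0]; use c in algebra)
    moreover have "\<ominus> z \<oplus> x = x \<ominus> z" using c by algebra
    ultimately have mzx: "\<ominus> z \<ominus> x \<in> X" using nxz by simp
    have mx: "\<ominus> x \<notin> X"
    proof
      assume "\<ominus> x \<in> X"
      then show False using N[of "\<ominus> x" x] x c by (simp add: minus_eq)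
    qed
    have "z \<oplus> z \<oplus> x \<in> X \<or> \<ominus> x \<in> X"
      by (rule semiaffineD[OF sa z zx 0]; use c in algebra)
    with mx have zzx: "z \<oplus> z \<oplus> x \<in> X" by blast
    \<comment> \<open>The neighbours of \<open>2z + x\<close> at distance \<open>x\<close> differ by
      \<open>2x\<close>, so only one of them can lie in \<open>X\<close>; each alternative is
      refuted in turn.\<close>
    have "z \<oplus> z \<in> X \<or> z \<oplus> z \<oplus> x \<oplus> x \<in> X"
      using semiaffineD[OF sa zzx 0 x, of "z \<oplus> z" "z \<oplus> z \<oplus> x \<oplus> x"] c by algebra
    then show False
    proof
      assume zz: "z \<oplus> z \<in> X"
      have n: "z \<oplus> z \<oplus> x \<oplus> x \<notin> X"
        by (rule N[OF zz]; use c in algebra)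
      have "z \<oplus> z \<oplus> x \<oplus> x \<in> X \<or> \<ominus> (z \<oplus> z) \<in> X"
        by (rule semiaffineD[OF sa x zzx 0]; use c in algebra)
      with n have mzz0: "\<ominus> (z \<oplus> z) \<in> X" by blast
      have mzz: "\<ominus> (z \<oplus> z \<oplus> x \<oplus> x) \<notin> X"
      proof
        assume "\<ominus> (z \<oplus> z \<oplus> x \<oplus> x) \<in> X"
        then have "\<ominus> (z \<oplus> z) \<notin> X"
          by (rule N; use c in algebra)
        with mzz0 show False by blast
      qed
      \<comment> \<open>\<open>2z + 2x\<close> is the difference of \<open>z + x\<close> and
        \<open>-z - x\<close>, so semiaffinity at \<open>\<zero>\<close> demands it or its negative,
        and both are excluded.\<close>
      have "z \<oplus> z \<oplus> x \<oplus> x \<in> X \<or> \<ominus> (z \<oplus> z \<oplus> x \<oplus> x) \<in> X"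
        by (rule semiaffineD[OF sa 0 zx mzx]; use c in algebra)
      with n mzz show False by blast
    next
      assume zz: "z \<oplus> z \<oplus> x \<oplus> x \<in> X"
      have n: "z \<oplus> z \<notin> X"
      proof
        assume "z \<oplus> z \<in> X"
        from N[OF this, of "z \<oplus> z \<oplus> x \<oplus> x"] zz c show False by algebra
      qed
      have "z \<oplus> z \<in> X \<or> \<ominus> (z \<oplus> z) \<in> X"
        by (rule semiaffineD[OF sa 0 z mz]; use c in algebra)
      with n have mzz: "\<ominus> (z \<oplus> z) \<in> X" by blast
      \<comment> \<open>The aim is to decide the sign of \<open>3z = z - (-2z)\<close>. Having
        \<open>-3z - 2x\<close> in \<open>X\<close> excludes \<open>-3z\<close>, hence
        \<open>3z\<close> is in \<open>X\<close> and \<open>3z + 2x\<close> is not. Then both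
        neighbours of \<open>2z + 2x\<close> at distance \<open>z\<close> are missing.\<close>
      have "z \<oplus> x \<oplus> x \<in> X \<or> \<ominus> (z \<oplus> z \<oplus> z \<oplus> x \<oplus> x) \<in> X"
        by (rule semiaffineD[OF sa mz zz 0]; use c in algebra)
      with z2x have "\<ominus> (z \<oplus> z \<oplus> z \<oplus> x \<oplus> x) \<in> X" by blast
      then have n3: "\<ominus> (z \<oplus> z \<oplus> z) \<notin> X"
        by (rule N; use c in algebra)
      have "z \<oplus> z \<oplus> z \<in> X \<or> \<ominus> (z \<oplus> z \<oplus> z) \<in> X"
        by (rule semiaffineD[OF sa 0 z mzz]; use c in algebra)
      with n3 have "z \<oplus> z \<oplus> z \<in> X" by blast
      then have n4: "z \<oplus> z \<oplus> z \<oplus> x \<oplus> x \<notin> X"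
        by (rule N; use c in algebra)
      have "z \<oplus> z \<oplus> z \<oplus> x \<oplus> x \<in> X \<or> z \<oplus> x \<oplus> x \<in> X"
        by (rule semiaffineD[OF sa zz z 0]; use c in algebra)
      with n4 z2x show False by blast
    qed
  qed
qed

lemma additive_subgroup_diffI:
  assumes "H \<subseteq> carrier G" "\<zero> \<in> H" and diff: "\<And>x y. x \<in> H \<Longrightarrow> y \<in> H \<Longrightarrow> x \<ominus> y \<in> H"
  shows "additive_subgroup H G"
proof (rule additive_subgroupI, rule add.subgroupI)
  show "H \<subseteq> carrier G" "H \<noteq> {}" using assms by auto
  show neg: "\<ominus> a \<in> H" if "a \<in> H" for a
    using diff[OF assms(2) that] that assms(1) by (simp add: minus_eq subset_iff)
  show "a \<oplus> b \<in> H" if "a \<in> H" "b \<in> H" for a b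
    using diff[OF that(1) neg[OF that(2)]] that assms(1) by (simp add: minus_eq subset_iff)
qed

text \<open>For \<open>v\<close> in \<open>X\<close>, either \<open>v + x\<close> or
  \<open>v - x\<close> is in \<open>X\<close>, which puts \<open>v\<close> into \<open>P\<close> or
  \<open>P + x\<close>. The subgroup property of \<open>P\<close> is where the reflection
  enters.\<close>

lemma semiaffine_two_cosets:
  assumes sa: "semiaffine G X" and 0: "\<zero> \<in> X" and x: "x \<in> X"
    and nE: "x \<oplus> x \<notin> diffs G X"
  obtains P where "additive_subgroup P G" "X = P \<union> (P +> x)"
proof
  let ?P = "{z \<in> X. z \<oplus> x \<in> X}"
  have sub: "X \<subseteq> carrier G" using sa by (simp add: semiaffine_def)
  have xc: "x \<in> carrier G" using x sub by auto
  have N: "w \<notin> X" if "v \<in> X" "w \<ominus> v = x \<oplus> x" for v w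
    using nE diffsI[OF _ that] by blast
  note reflect = semiaffine_reflect[OF sa 0 x nE]
  have neg: "\<ominus> z \<in> ?P" if "z \<in> ?P" for z
  proof -
    have "z \<in> carrier G" using that sub by auto
    then have "x \<ominus> z = \<ominus> z \<oplus> x" using xc by algebra
    then show ?thesis using reflect[of z] that by auto
  qed
  have diff_X: "z \<ominus> w \<in> ?P" if zw: "z \<in> ?P" "w \<in> ?P" and t: "z \<ominus> w \<in> X" for z w
  proof (rule ccontr)
    assume "z \<ominus> w \<notin> ?P"
    with t have ntx: "z \<ominus> w \<oplus> x \<notin> X" by simp
    have c: "z \<in> carrier G" "w \<in> carrier G" using zw sub by auto
    note c = c xc
    \<comment> \<open>Write \<open>t = z - w\<close>. If \<open>t + x\<close> is missing, then
      \<open>t - x\<close> lies in \<open>P\<close>, so its negative is in \<open>X\<close> and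
      excludes \<open>-(t + x)\<close>. But \<open>t + x\<close> is the difference of
      \<open>z + x\<close> and \<open>w\<close>, so one of its signs must occur.\<close>
    have "z \<ominus> w \<oplus> x \<in> X \<or> z \<ominus> w \<ominus> x \<in> X"
      by (rule semiaffineD[OF sa t x 0]; use c in algebra)
    with ntx have tx: "z \<ominus> w \<ominus> x \<in> X" by blast
    have "z \<ominus> w \<ominus> x \<oplus> x = z \<ominus> w" using c by algebra
    with t have mtx: "\<ominus> (z \<ominus> w \<ominus> x) \<in> X"
      using reflect(1)[OF tx] by simp
    have "\<ominus> (z \<ominus> w \<oplus> x) \<notin> X"
    proof
      assume "\<ominus> (z \<ominus> w \<oplus> x) \<in> X"
      then have "\<ominus> (z \<ominus> w \<ominus> x) \<notin> X"
        by (rule N; use c in algebra)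
      then show False using mtx by blast
    qed
    moreover have "z \<ominus> w \<oplus> x \<in> X \<or> \<ominus> (z \<ominus> w \<oplus> x) \<in> X"
    proof (rule semiaffineD[OF sa 0])
      show "z \<oplus> x \<in> X" "w \<in> X" using zw by auto
    qed (use c in algebra)+
    ultimately show False using ntx by blast
  qed
  show "additive_subgroup ?P G"
  proof (rule additive_subgroup_diffI)
    show "?P \<subseteq> carrier G" "\<zero> \<in> ?P" using sub 0 x xc by auto
    fix z w assume zw: "z \<in> ?P" "w \<in> ?P"
    then have c: "z \<in> carrier G" "w \<in> carrier G" using sub by auto
    have "z \<ominus> w \<in> X \<or> w \<ominus> z \<in> X"
    proof (rule semiaffineD[OF sa 0])
      show "z \<in> X" "w \<in> X" using zw by auto
    qed (use c in algebra)+
    then show "z \<ominus> w \<in> ?P"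
    proof
      assume "w \<ominus> z \<in> X"
      then have "\<ominus> (w \<ominus> z) \<in> ?P" using neg diff_X zw by blast
      moreover have "\<ominus> (w \<ominus> z) = z \<ominus> w" using c by algebra
      ultimately show ?thesis by simp
    qed (use diff_X zw in blast)
  qed
  show "X = ?P \<union> (?P +> x)"
  proof
    show "X \<subseteq> ?P \<union> (?P +> x)"
    proof
      fix v assume v: "v \<in> X"
      then have c: "v \<in> carrier G" using sub by auto
      have "v \<oplus> x \<in> X \<or> v \<ominus> x \<in> X"
        by (rule semiaffineD[OF sa v x 0]; use c xc in algebra)
      moreover have "v \<ominus> x \<oplus> x = v" using c xc by algebra
      ultimately show "v \<in> ?P \<union> (?P +> x)"
        using v unfolding a_r_coset_def' by force
    qed
    show "?P \<union> (?P +> x) \<subseteq> X" by (auto simp: a_r_coset_def')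
  qed
qed

section \<open>The case where the differences form a subgroup: midconvex complement\<close>

lemma semiaffine_diffs_eq:
  assumes sa: "semiaffine G X" and 0: "\<zero> \<in> X"
  shows "diffs G X = X \<union> {\<ominus> x | x. x \<in> X}"
proof
  have sub: "X \<subseteq> carrier G" using sa by (simp add: semiaffine_def)
  show "diffs G X \<subseteq> X \<union> {\<ominus> x | x. x \<in> X}"
  proof
    fix d assume "d \<in> diffs G X"
    then obtain y z where yz: "y \<in> X" "z \<in> X" "d = y \<ominus> z" by (auto simp: diffs_def)
    then have c: "y \<in> carrier G" "z \<in> carrier G" using sub by auto
    \<comment> \<open>Semiaffinity at \<open>\<zero>\<close> moves \<open>\<zero>\<close> to
      \<open>d\<close> or to its negative.\<close>
    have "d \<in> X \<or> \<ominus> d \<in> X"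
      unfolding yz(3) by (rule semiaffineD[OF sa 0 yz(1,2)]; use c in algebra)
    moreover have "\<ominus> (\<ominus> d) = d" using c yz(3) by simp
    ultimately show "d \<in> X \<union> {\<ominus> x | x. x \<in> X}" by force
  qed
  have "x \<in> diffs G X" "\<ominus> x \<in> diffs G X" if "x \<in> X" for x
    using diffsI[OF that 0, of G x] diffsI[OF 0 that, of G "\<ominus> x"] that sub
    by (auto simp: minus_eq)
  then show "X \<union> {\<ominus> x | x. x \<in> X} \<subseteq> diffs G X" by blast
qed

lemma semiaffine_diffs_subgroup:
  assumes sa: "semiaffine G X" and 0: "\<zero> \<in> X"
    and dbl: "\<And>x. x \<in> X \<Longrightarrow> x \<oplus> x \<in> diffs G X"
  shows "additive_subgroup (diffs G X) G"
proof (rule additive_subgroup_diffI)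
  have sub: "X \<subseteq> carrier G" using sa by (simp add: semiaffine_def)
  then show subE: "diffs G X \<subseteq> carrier G" by (auto simp: diffs_def)
  note E = semiaffine_diffs_eq[OF sa 0]
  show "\<zero> \<in> diffs G X" using 0 E by auto
  have neg: "\<ominus> d \<in> diffs G X" if "d \<in> diffs G X" for d
    using that sub unfolding E by (auto simp: subset_iff)
  have add: "x \<oplus> y \<in> diffs G X" if xy: "x \<in> X" "y \<in> X" for x y
  proof (rule ccontr)
    assume nE: "x \<oplus> y \<notin> diffs G X"
    then have nX: "x \<oplus> y \<notin> X" using E by blast
    have c: "x \<in> carrier G" "y \<in> carrier G" using xy sub by auto
    have "x \<oplus> y \<in> X \<or> x \<ominus> y \<in> X"
      by (rule semiaffineD[OF sa xy 0]; use c in algebra)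
    with nX have p: "x \<ominus> y \<in> X" by blast
    have "x \<oplus> y \<in> X \<or> y \<ominus> x \<in> X"
      by (rule semiaffineD[OF sa xy(2,1) 0]; use c in algebra)
    with nX have q: "y \<ominus> x \<in> X" by blast
    from dbl[OF xy(1)] consider "x \<oplus> x \<in> X" | w where "w \<in> X" "x \<oplus> x = \<ominus> w"
      unfolding E by blast
    then have "x \<oplus> y \<in> diffs G X"
    proof cases
      case 1
      show ?thesis by (rule diffsI[OF 1 p]; use c in algebra)
    next
      case 2
      then have w: "w \<in> carrier G" using sub by auto
      have "y \<ominus> x \<ominus> w = y \<ominus> x \<oplus> \<ominus> w" by (simp add: minus_eq)
      also have "\<dots> = y \<ominus> x \<oplus> (x \<oplus> x)" using 2 by simp
      also have "\<dots> = x \<oplus> y" using c by algebra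
      finally show ?thesis by (rule diffsI[OF q 2(1)])
    qed
    with nE show False by blast
  qed
  fix d e assume de: "d \<in> diffs G X" "e \<in> diffs G X"
  have diff: "x \<ominus> y \<in> diffs G X" if "x \<in> X" "y \<in> X" for x y
    using diffsI[OF that] by blast
  \<comment> \<open>In the four sign cases, \<open>d - e\<close> is up to sign a sum or a difference
    of two elements of \<open>X\<close>.\<close>
  from de(1) consider "d \<in> X" | x where "x \<in> X" "d = \<ominus> x" unfolding E by blast
  then show "d \<ominus> e \<in> diffs G X"
  proof cases
    case d: 1
    from de(2) consider "e \<in> X" | y where "y \<in> X" "e = \<ominus> y" unfolding E by blast
    then show ?thesis
      using add[OF d] diff[OF d] sub by cases (auto simp: minus_eq subset_iff)
  next
    case d: 2
    then have xc: "x \<in> carrier G" using sub by auto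
    from de(2) consider "e \<in> X" | y where "y \<in> X" "e = \<ominus> y" unfolding E by blast
    then show ?thesis
    proof cases
      case 1
      then have "e \<in> carrier G" using sub by auto
      then have "d \<ominus> e = \<ominus> (x \<oplus> e)" using d(2) xc by algebra
      then show ?thesis using neg[OF add[OF d(1) 1]] by simp
    next
      case 2
      then have "y \<in> carrier G" using sub by auto
      then have "d \<ominus> e = y \<ominus> x" using d(2) 2(2) xc by algebra
      then show ?thesis using diff[OF 2(1) d(1)] by simp
    qed
  qed
qed

text \<open>The leading \<open>\<zero>\<close> is the start of the recursion for multiples. Keeping
  it makes the equation hold for any set \<open>H\<close>, without closure assumptions.\<close>

lemma midpoints_subgroup:
  "midpoints (G\<lparr>carrier := H\<rparr>) x y = {z \<in> H. \<zero> \<oplus> z \<oplus> z = x \<oplus> y}"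
  by (simp add: midpoints_def add_pow_def nat_pow_def numeral_2_eq_2)

text \<open>If \<open>z\<close> in \<open>X\<close> is a midpoint of \<open>u\<close> and
  \<open>v\<close>, then \<open>u = z + d\<close> and \<open>v = z - d\<close> for
  \<open>d = u - z\<close>. The subgroup property makes \<open>d\<close> a difference of elements of
  \<open>X\<close>, so \<open>u\<close> or \<open>v\<close> lies in \<open>X\<close>.\<close>

lemma midconvex_diffs_minus:
  assumes sa: "semiaffine G X" and 0: "\<zero> \<in> X" and H: "additive_subgroup (diffs G X) G"
  shows "midconvex (G\<lparr>carrier := diffs G X\<rparr>) (diffs G X - X)"
proof -
  interpret H: additive_subgroup "diffs G X" G by (rule H)
  have False if u: "u \<in> diffs G X" "u \<notin> X" and v: "v \<notin> X" "v \<in> diffs G X" and z: "z \<in> X"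
    and eq: "\<zero> \<oplus> z \<oplus> z = u \<oplus> v" for u v z
  proof -
    have zE: "z \<in> diffs G X" using z semiaffine_diffs_eq[OF sa 0] by blast
    have c: "u \<in> carrier G" "v \<in> carrier G" "z \<in> carrier G"
      using u v zE H.a_subset by auto
    have "u \<ominus> z \<in> diffs G X"
      using u zE by (simp add: minus_eq)
    then obtain p q where pq: "p \<in> X" "q \<in> X" "u \<ominus> z = p \<ominus> q" by (auto simp: diffs_def)
    have "z \<oplus> (u \<ominus> z) = u" using c by algebra
    moreover have "z \<ominus> (u \<ominus> z) = v"
    proof -
      have "z \<ominus> (u \<ominus> z) = (\<zero> \<oplus> z \<oplus> z) \<ominus> u" using c by algebra
      also have "\<dots> = v" unfolding eq using c by algebra
      finally show ?thesis .
    qed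
    ultimately have "u \<in> X \<or> v \<in> X"
      using semiaffineD[OF sa z pq(1,2)] pq(3) by simp
    with u v show False by blast
  qed
  then show ?thesis
    unfolding midconvex_def midpoints_subgroup by auto
qed

section \<open>Translation, and semiaffinity of the two standard forms\<close>

lemma semiaffine_translate:
  assumes sa: "semiaffine G X" and p: "p \<in> carrier G"
  shows "semiaffine G (X +> p)"
proof -
  have sub: "X \<subseteq> carrier G" using sa by (simp add: semiaffine_def)
  have "(x \<oplus> p) \<oplus> ((y \<oplus> p) \<ominus> (z \<oplus> p)) \<in> X +> p \<or> (x \<oplus> p) \<ominus> ((y \<oplus> p) \<ominus> (z \<oplus> p)) \<in> X +> p"
    if xyz: "x \<in> X" "y \<in> X" "z \<in> X" for x y z
  proof -
    have c: "x \<in> carrier G" "y \<in> carrier G" "z \<in> carrier G" using xyz sub by auto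
    have "(x \<oplus> p) \<oplus> ((y \<oplus> p) \<ominus> (z \<oplus> p)) = (x \<oplus> (y \<ominus> z)) \<oplus> p"
      "(x \<oplus> p) \<ominus> ((y \<oplus> p) \<ominus> (z \<oplus> p)) = (x \<ominus> (y \<ominus> z)) \<oplus> p"
      using c p by algebra+
    moreover have "x \<oplus> (y \<ominus> z) \<in> X \<or> x \<ominus> (y \<ominus> z) \<in> X"
      using semiaffineD[OF sa xyz] by blast
    ultimately show ?thesis unfolding a_r_coset_def' by auto
  qed
  moreover have "X +> p \<subseteq> carrier G" using a_r_coset_subset_G sub p by blast
  ultimately show ?thesis
    unfolding semiaffine_def by (auto simp: a_r_coset_def')
qed

text \<open>Two of the three points share a coset, so their difference is in \<open>H\<close>, and
  adding it to the third point stays in that point's coset. The identities \<open>eq\<close> bring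
  the outcomes into this shape for each choice of the pair.\<close>

lemma semiaffine_cosets:
  assumes H: "additive_subgroup H G" and ab: "a \<in> carrier G" "b \<in> carrier G"
  shows "semiaffine G ((H +> a) \<union> (H +> b))"
proof -
  interpret H: additive_subgroup H G by (rule H)
  have same: "x \<oplus> (y \<ominus> z) \<in> H +> c"
    if x: "x \<in> H +> c" and y: "y \<in> H +> d" and z: "z \<in> H +> d"
      and c: "c \<in> carrier G" "d \<in> carrier G" for x y z c d
  proof -
    from x y z obtain h k l where h: "h \<in> H" "k \<in> H" "l \<in> H"
      "x = h \<oplus> c" "y = k \<oplus> d" "z = l \<oplus> d"
      unfolding a_r_coset_def' by blast
    then have hc: "h \<in> carrier G" "k \<in> carrier G" "l \<in> carrier G" using H.a_subset by auto
    have "x \<oplus> (y \<ominus> z) = (h \<oplus> (k \<ominus> l)) \<oplus> c"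
      unfolding h using hc c by algebra
    moreover have "h \<oplus> (k \<ominus> l) \<in> H" using h by (simp add: minus_eq)
    ultimately show ?thesis unfolding a_r_coset_def' by blast
  qed
  have sub: "(H +> a) \<union> (H +> b) \<subseteq> carrier G"
    using a_r_coset_subset_G[OF H.a_subset] ab by blast
  show ?thesis unfolding semiaffine_def
  proof (intro conjI ballI sub)
    fix x y z
    assume x: "x \<in> (H +> a) \<union> (H +> b)" and y: "y \<in> (H +> a) \<union> (H +> b)"
      and z: "z \<in> (H +> a) \<union> (H +> b)"
    then have c: "x \<in> carrier G" "y \<in> carrier G" "z \<in> carrier G" using sub by auto
    have eq: "x \<oplus> (y \<ominus> z) = y \<oplus> (x \<ominus> z)" "x \<ominus> (y \<ominus> z) = z \<oplus> (x \<ominus> y)"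
      "x \<ominus> (y \<ominus> z) = x \<oplus> (z \<ominus> y)"
      using c by algebra+
    show "x \<oplus> (y \<ominus> z) \<in> (H +> a) \<union> (H +> b) \<or> x \<ominus> (y \<ominus> z) \<in> (H +> a) \<union> (H +> b)"
      using x y z same[OF _ _ _ ab] same[OF _ _ _ ab(2,1)]
        same[OF _ _ _ ab(1,1)] same[OF _ _ _ ab(2,2)] eq
      by (metis Un_iff)
  qed
qed

text \<open>\<open>x\<close> is a midpoint of the two outcomes \<open>x + (y - z)\<close> and
  \<open>x - (y - z)\<close>. If both fell into \<open>C\<close>, so would \<open>x\<close>.\<close>

lemma semiaffine_subgroup_minus_midconvex:
  assumes H: "additive_subgroup H G" and C: "midconvex (G\<lparr>carrier := H\<rparr>) C"
  shows "semiaffine G (H - C)"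
proof -
  interpret H: additive_subgroup H G by (rule H)
  have "x \<oplus> (y \<ominus> z) \<in> H - C \<or> x \<ominus> (y \<ominus> z) \<in> H - C"
    if xyz: "x \<in> H - C" "y \<in> H - C" "z \<in> H - C" for x y z
  proof (rule ccontr)
    assume n: "\<not> ?thesis"
    have c: "x \<in> carrier G" "y \<in> carrier G" "z \<in> carrier G" using xyz H.a_subset by auto
    have "x \<oplus> (y \<ominus> z) \<in> H" "x \<ominus> (y \<ominus> z) \<in> H"
      using xyz by (simp_all add: minus_eq)
    with n have "x \<oplus> (y \<ominus> z) \<in> C" "x \<ominus> (y \<ominus> z) \<in> C" by auto
    moreover have "\<zero> \<oplus> x \<oplus> x = (x \<oplus> (y \<ominus> z)) \<oplus> (x \<ominus> (y \<ominus> z))"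
      using c by algebra
    ultimately have "x \<in> C"
      using C xyz unfolding midconvex_def midpoints_subgroup by blast
    with xyz show False by simp
  qed
  then show ?thesis
    unfolding semiaffine_def using H.a_subset by blast
qed

end

section \<open>Reduction to a set containing zero, and the equivalence\<close>

theorem theorem1:
  fixes G :: "('a, 'm) ring_scheme" and X :: "'a set"
  assumes "abelian_group G" and "X \<subseteq> carrier G"
  shows "semiaffine G X \<longleftrightarrow>
    (\<exists>H a b. additive_subgroup H G \<and> a \<in> X \<and> b \<in> X \<and>
       X = (H +>\<^bsub>G\<^esub> a) \<union> (H +>\<^bsub>G\<^esub> b)) \<or>
    (\<exists>g H C. g \<in> carrier G \<and> additive_subgroup H G \<and> midconvex (G\<lparr>carrier := H\<rparr>) C \<and>
       X = (H - C) +>\<^bsub>G\<^esub> g)"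
    (is "_ \<longleftrightarrow> ?cosets \<or> ?complement")
proof
  interpret abelian_group G by fact
  assume sa: "semiaffine G X"
  show "?cosets \<or> ?complement"
  proof (cases "X = {}")
    case True
    \<comment> \<open>The empty set has the second form with \<open>H\<close> and \<open>C\<close>
      both the trivial group.\<close>
    have "additive_subgroup {\<zero>\<^bsub>G\<^esub>} G"
      by (rule additive_subgroup_diffI) (auto simp: minus_eq)
    moreover have "midconvex (G\<lparr>carrier := {\<zero>\<^bsub>G\<^esub>}\<rparr>) {\<zero>\<^bsub>G\<^esub>}"
      by (auto simp: midconvex_def midpoints_def)
    moreover have "X = ({\<zero>\<^bsub>G\<^esub>} - {\<zero>\<^bsub>G\<^esub>}) +>\<^bsub>G\<^esub> \<zero>\<^bsub>G\<^esub>"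
      using True by (simp add: a_r_coset_def')
    ultimately show ?thesis using zero_closed by blast
  next
    case False
    then obtain p where p: "p \<in> X" by blast
    then have pc: "p \<in> carrier G" using assms(2) by blast
    define Y where "Y = X +>\<^bsub>G\<^esub> (\<ominus>\<^bsub>G\<^esub> p)"
    have saY: "semiaffine G Y"
      unfolding Y_def using semiaffine_translate[OF sa] pc by simp
    then have Yc: "Y \<subseteq> carrier G" by (simp add: semiaffine_def)
    have 0: "\<zero>\<^bsub>G\<^esub> \<in> Y"
      unfolding Y_def a_r_coset_def' using p pc by (auto intro!: bexI[of _ p] simp: r_neg)
    have X: "X = Y +>\<^bsub>G\<^esub> p"
      unfolding Y_def using assms(2) pc by (simp add: a_coset_add_assoc l_neg a_coset_add_zero)
    show ?thesis
    proof (cases "\<exists>x\<in>Y. x \<oplus>\<^bsub>G\<^esub> x \<notin> diffs G Y")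
      case True
      then obtain x where x: "x \<in> Y" "x \<oplus>\<^bsub>G\<^esub> x \<notin> diffs G Y" by blast
      obtain P where P: "additive_subgroup P G" "Y = P \<union> (P +>\<^bsub>G\<^esub> x)"
        using semiaffine_two_cosets[OF saY 0 x] .
      have "X = (P +>\<^bsub>G\<^esub> p) \<union> (P +>\<^bsub>G\<^esub> x +>\<^bsub>G\<^esub> p)"
        unfolding X by (subst P(2)) (auto simp: a_r_coset_def')
      also have "P +>\<^bsub>G\<^esub> x +>\<^bsub>G\<^esub> p = P +>\<^bsub>G\<^esub> (x \<oplus>\<^bsub>G\<^esub> p)"
        using x(1) Yc pc additive_subgroup.a_subset[OF P(1)]
        by (intro a_coset_add_assoc) auto
      finally have "X = (P +>\<^bsub>G\<^esub> p) \<union> (P +>\<^bsub>G\<^esub> (x \<oplus>\<^bsub>G\<^esub> p))" .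
      \<comment> \<open>The representatives \<open>p\<close> and \<open>x + p\<close> are the
        translates of \<open>\<zero>\<close> and \<open>x\<close>, both in \<open>Y\<close>.\<close>
      moreover have "x \<oplus>\<^bsub>G\<^esub> p \<in> X"
        unfolding X using x(1) by (auto simp: a_r_coset_def')
      ultimately show ?thesis using P(1) p by blast
    next
      case False
      then have H: "additive_subgroup (diffs G Y) G"
        using semiaffine_diffs_subgroup[OF saY 0] by blast
      \<comment> \<open>As \<open>\<zero>\<close> is in \<open>Y\<close>, the differences contain
        \<open>Y\<close>, and taking the complement twice returns \<open>Y\<close>.\<close>
      have "Y = diffs G Y - (diffs G Y - Y)"
        using semiaffine_diffs_eq[OF saY 0] by blast
      then have "X = (diffs G Y - (diffs G Y - Y)) +>\<^bsub>G\<^esub> p" using X by simp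
      then show ?thesis
        using H midconvex_diffs_minus[OF saY 0 H] pc by blast
    qed
  qed
next
  interpret abelian_group G by fact
  assume "?cosets \<or> ?complement"
  then show "semiaffine G X"
  proof
    assume ?cosets
    then show ?thesis using semiaffine_cosets assms(2) by blast
  next
    assume ?complement
    then show ?thesis
      using semiaffine_translate semiaffine_subgroup_minus_midconvex by blast
  qed
qed

end
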